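(* Let $k'\in\mathcal{K}_\omega$ and $k\in\mathrm{conj}(k')$. For every $f\in L^1([a,b];\mathbb{R})$, we have $$D_a^{k'}(I_a^kf)(x)= f(x),\quad \text{a.e. } x\in[a,b]$$ and $$D_b^{k'}(I_b^kf)(x)= f(x),\quad \text{a.e. } x\in[a,b].$$
   Context: Let $a<b$ be real numbers, $\mathbb{R}_+=(0,+\infty)$, and $\Omega=\{(x,y)\in[a,b]\times[a,b] : x>y\}$. Fix a weight function $\omega:[a,b]\to\mathbb{R}_+$ such that $\omega,\omega^{-1}\in L^\infty([a,b];\mathbb{R})$, where $\omega^{-1}=1/\omega$. For a (measurable) kernel-function $k:\Omega\to\mathbb{R}_+$ put $F_k(y)=\int_y^b k(x,y)\omega(x)\,dx$ for $y\in[a,b)$ and $G_k(y)=\int_a^y k(y,x)\omega(x)\,dx$ for $y\in(a,b]$. Let $\mathcal{K}_\omega$ be the set of measurable $k:\Omega\to\mathbb{R}_+$ such that $F_k\in L^\infty([a,b);\mathbb{R})$ and $G_k\in L^\infty((a,b];\mathbb{R})$. For $k_1,k_2\in\mathcal{K}_\omega$ put $\delta_{k_1,k_2}(x,y)=\int_y^x k_1(x,z)k_2(z,y)\omega(z)\,dz$ for $(x,y)\in\Omega$. Kernels $k,k'\in\mathcal{K}_\omega$ are conjugate if $\delta_{k,k'}(x,y)=\delta_{k',k}(x,y)=1$ for all $(x,y)\in\Omega$; $\mathrm{conj}(k')$ is the set of $k\in\mathcal{K}_\omega$ such that $k$ and $k'$ are conjugate. For $k\in\mathcal{K}_\omega$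 and $f\in L^1([a,b];\mathbb{R})$ the $k$-integrals are, for a.e. $x\in[a,b]$, $(I_a^kf)(x)=\int_a^x k(x,y)f(y)\omega(y)\,dy$ and $(I_b^kf)(x)=\int_x^b k(y,x)f(y)\omega(y)\,dy$. A function in $L^1([a,b];\mathbb{R})$ has an absolutely continuous representative if it agrees a.e. with an absolutely continuous function on $[a,b]$, with which it is then identified. If $f\in L^1([a,b];\mathbb{R})$ and $I_a^{k'}f$ has an absolutely continuous representative, the left-sided $k'$-derivative of $f$ is $(D_a^{k'}f)(x)=\frac{1}{\omega(x)}\frac{d}{dx}(I_a^{k'}f)(x)$ for a.e. $x$. If $I_b^{k'}f$ has an absolutely continuous representative, the right-sided $k'$-derivative is $(D_b^{k'}f)(x)=-\frac{1}{\omega(x)}\frac{d}{dx}(I_b^{k'}f)(x)$ for a.e. $x$. An identity involving a $k'$-derivative asserts in particular that this derivative is defined. *)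

theory Defs
  imports "HOL-Analysis.Analysis"
begin

text \<open>
  Measurability, integrals and ``almost everywhere'' refer to Lebesgue measure. Functions on
  [a,b] and kernels on \<Omega> are total functions on the reals; only their values on [a,b] and on
  \<Omega> are ever used, up to the null set of end points in \<^term>\<open>deriv\<close> below.
\<close>

definition L_infty :: "real set \<Rightarrow> (real \<Rightarrow> real) \<Rightarrow> bool" where
  "L_infty S f \<longleftrightarrow> f \<in> borel_measurable (lebesgue_on S) \<and>
     (\<exists>C. AE x in lebesgue_on S. \<bar>f x\<bar> \<le> C)"

definition weight :: "real \<Rightarrow> real \<Rightarrow> (real \<Rightarrow> real) \<Rightarrow> bool" where
  "weight a b \<omega> \<longleftrightarrow> (\<forall>x\<in>{a..b}. \<omega> x > 0) \<and> L_infty {a..b} \<omega> \<and> L_infty {a..b} (\<lambda>x. 1 / \<omega> x)"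

definition Omega :: "real \<Rightarrow> real \<Rightarrow> (real \<times> real) set" where
  "Omega a b = {(x, y). x \<in> {a..b} \<and> y \<in> {a..b} \<and> x > y}"

definition F_ker :: "real \<Rightarrow> (real \<Rightarrow> real) \<Rightarrow> (real \<Rightarrow> real \<Rightarrow> real) \<Rightarrow> real \<Rightarrow> real" where
  "F_ker b \<omega> k y = (LINT x|lebesgue_on {y<..b}. k x y * \<omega> x)"

definition G_ker :: "real \<Rightarrow> (real \<Rightarrow> real) \<Rightarrow> (real \<Rightarrow> real \<Rightarrow> real) \<Rightarrow> real \<Rightarrow> real" where
  "G_ker a \<omega> k y = (LINT x|lebesgue_on {a..<y}. k y x * \<omega> x)"

text \<open>
  The Bochner integral of a non-integrable function is 0, so finiteness almost everywhere of the
  (a priori possibly infinite) integrals F and G is required explicitly.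
\<close>

definition kernels :: "real \<Rightarrow> real \<Rightarrow> (real \<Rightarrow> real) \<Rightarrow> (real \<Rightarrow> real \<Rightarrow> real) set" where
  "kernels a b \<omega> = {k.
     (\<forall>(x, y)\<in>Omega a b. k x y > 0) \<and>
     (\<lambda>(x, y). k x y) \<in> borel_measurable (lebesgue_on (Omega a b)) \<and>
     (AE y in lebesgue_on {a..<b}. integrable (lebesgue_on {y<..b}) (\<lambda>x. k x y * \<omega> x)) \<and>
     L_infty {a..<b} (F_ker b \<omega> k) \<and>
     (AE y in lebesgue_on {a<..b}. integrable (lebesgue_on {a..<y}) (\<lambda>x. k y x * \<omega> x)) \<and>
     L_infty {a<..b} (G_ker a \<omega> k)}"

definition delta_ker ::
  "(real \<Rightarrow> real) \<Rightarrow> (real \<Rightarrow> real \<Rightarrow> real) \<Rightarrow> (real \<Rightarrow> real \<Rightarrow> real) \<Rightarrow> real \<Rightarrow> real \<Rightarrow> real" where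
  "delta_ker \<omega> k1 k2 x y = (LINT z|lebesgue_on {y<..<x}. k1 x z * k2 z y * \<omega> z)"

text \<open>
  A non-integrable integrand would give the value 0 here, so the value 1 entails integrability.
\<close>

definition conjugate ::
  "real \<Rightarrow> real \<Rightarrow> (real \<Rightarrow> real) \<Rightarrow> (real \<Rightarrow> real \<Rightarrow> real) \<Rightarrow> (real \<Rightarrow> real \<Rightarrow> real) \<Rightarrow> bool" where
  "conjugate a b \<omega> k k' \<longleftrightarrow> k \<in> kernels a b \<omega> \<and> k' \<in> kernels a b \<omega> \<and>
     (\<forall>(x, y)\<in>Omega a b. delta_ker \<omega> k k' x y = 1 \<and> delta_ker \<omega> k' k x y = 1)"

definition conj_set ::
  "real \<Rightarrow> real \<Rightarrow> (real \<Rightarrow> real) \<Rightarrow> (real \<Rightarrow> real \<Rightarrow> real) \<Rightarrow> (real \<Rightarrow> real \<Rightarrow> real) set" where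
  "conj_set a b \<omega> k' = {k \<in> kernels a b \<omega>. conjugate a b \<omega> k k'}"

definition L_one :: "real \<Rightarrow> real \<Rightarrow> (real \<Rightarrow> real) \<Rightarrow> bool" where
  "L_one a b f \<longleftrightarrow> integrable (lebesgue_on {a..b}) f"

definition left_int ::
  "real \<Rightarrow> (real \<Rightarrow> real) \<Rightarrow> (real \<Rightarrow> real \<Rightarrow> real) \<Rightarrow> (real \<Rightarrow> real) \<Rightarrow> real \<Rightarrow> real" where
  "left_int a \<omega> k f x = (LINT y|lebesgue_on {a..<x}. k x y * f y * \<omega> y)"

definition right_int ::
  "real \<Rightarrow> (real \<Rightarrow> real) \<Rightarrow> (real \<Rightarrow> real \<Rightarrow> real) \<Rightarrow> (real \<Rightarrow> real) \<Rightarrow> real \<Rightarrow> real" where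
  "right_int b \<omega> k f x = (LINT y|lebesgue_on {x<..b}. k y x * f y * \<omega> y)"

text \<open>The integrals defining the k-integrals exist for almost every x.\<close>

definition left_int_defined ::
  "real \<Rightarrow> real \<Rightarrow> (real \<Rightarrow> real) \<Rightarrow> (real \<Rightarrow> real \<Rightarrow> real) \<Rightarrow> (real \<Rightarrow> real) \<Rightarrow> bool" where
  "left_int_defined a b \<omega> k f \<longleftrightarrow>
     (AE x in lebesgue_on {a..b}. integrable (lebesgue_on {a..<x}) (\<lambda>y. k x y * f y * \<omega> y))"

definition right_int_defined ::
  "real \<Rightarrow> real \<Rightarrow> (real \<Rightarrow> real) \<Rightarrow> (real \<Rightarrow> real \<Rightarrow> real) \<Rightarrow> (real \<Rightarrow> real) \<Rightarrow> bool" where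
  "right_int_defined a b \<omega> k f \<longleftrightarrow>
     (AE x in lebesgue_on {a..b}. integrable (lebesgue_on {x<..b}) (\<lambda>y. k y x * f y * \<omega> y))"

definition abs_continuous :: "real \<Rightarrow> real \<Rightarrow> (real \<Rightarrow> real) \<Rightarrow> bool" where
  "abs_continuous a b h \<longleftrightarrow> (\<forall>\<epsilon>>0. \<exists>\<delta>>0. \<forall>(n::nat) u v.
     (\<forall>i<n. a \<le> u i \<and> u i \<le> v i \<and> v i \<le> b) \<longrightarrow>
     disjoint_family_on (\<lambda>i. {u i<..<v i}) {..<n} \<longrightarrow>
     (\<Sum>i<n. v i - u i) < \<delta> \<longrightarrow> (\<Sum>i<n. \<bar>h (v i) - h (u i)\<bar>) < \<epsilon>)"

definition is_AC_rep :: "real \<Rightarrow> real \<Rightarrow> (real \<Rightarrow> real) \<Rightarrow> (real \<Rightarrow> real) \<Rightarrow> bool" where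
  "is_AC_rep a b g h \<longleftrightarrow> abs_continuous a b h \<and> (AE x in lebesgue_on {a..b}. h x = g x)"

definition has_AC_rep :: "real \<Rightarrow> real \<Rightarrow> (real \<Rightarrow> real) \<Rightarrow> bool" where
  "has_AC_rep a b g \<longleftrightarrow> (\<exists>h. is_AC_rep a b g h)"

text \<open>For a < b the representative is unique on [a,b], but arbitrary outside.\<close>

definition AC_rep :: "real \<Rightarrow> real \<Rightarrow> (real \<Rightarrow> real) \<Rightarrow> real \<Rightarrow> real" where
  "AC_rep a b g = (SOME h. is_AC_rep a b g h)"

definition left_deriv_defined ::
  "real \<Rightarrow> real \<Rightarrow> (real \<Rightarrow> real) \<Rightarrow> (real \<Rightarrow> real \<Rightarrow> real) \<Rightarrow> (real \<Rightarrow> real) \<Rightarrow> bool" where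
  "left_deriv_defined a b \<omega> k f \<longleftrightarrow>
     L_one a b f \<and> left_int_defined a b \<omega> k f \<and> has_AC_rep a b (left_int a \<omega> k f)"

definition right_deriv_defined ::
  "real \<Rightarrow> real \<Rightarrow> (real \<Rightarrow> real) \<Rightarrow> (real \<Rightarrow> real \<Rightarrow> real) \<Rightarrow> (real \<Rightarrow> real) \<Rightarrow> bool" where
  "right_deriv_defined a b \<omega> k f \<longleftrightarrow>
     L_one a b f \<and> right_int_defined a b \<omega> k f \<and> has_AC_rep a b (right_int b \<omega> k f)"

text \<open>
  Meaningful only if the corresponding definedness predicate holds, and then for almost every x
  in [a,b], since absolutely continuous functions are differentiable almost everywhere.
\<close>

definition left_deriv ::
  "real \<Rightarrow> real \<Rightarrow> (real \<Rightarrow> real) \<Rightarrow> (real \<Rightarrow> real \<Rightarrow> real) \<Rightarrow> (real \<Rightarrow> real) \<Rightarrow> real \<Rightarrow> real" where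
  "left_deriv a b \<omega> k f x = 1 / \<omega> x * deriv (AC_rep a b (left_int a \<omega> k f)) x"

definition right_deriv ::
  "real \<Rightarrow> real \<Rightarrow> (real \<Rightarrow> real) \<Rightarrow> (real \<Rightarrow> real \<Rightarrow> real) \<Rightarrow> (real \<Rightarrow> real) \<Rightarrow> real \<Rightarrow> real" where
  "right_deriv a b \<omega> k f x = - (1 / \<omega> x) * deriv (AC_rep a b (right_int b \<omega> k f)) x"

end

theory Submission
  imports Defs
begin

text \<open>
  By Fubini's theorem and conjugacy, the composition of the \<open>k'\<close>-integral with the \<open>k\<close>-integral of
  \<open>f\<close> at \<open>x\<close> is the integral of \<open>\<delta>(x,y) f(y) \<omega>(y)\<close> with \<open>\<delta> = 1\<close> on \<open>\<Omega>\<close>, that is, the indefinite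
  integral of \<open>f \<omega>\<close>. Only the bound on \<open>F\<close> (on the left) or \<open>G\<close> (on the right) of \<open>k\<close> is needed to
  make the inner integral finite; the outer use of Fubini is justified by \<open>\<delta> \<le> 1\<close>. The indefinite
  integral is absolutely continuous and differentiable almost everywhere by Lebesgue's theorem,
  which follows from Henstock's lemma together with the Vitali covering theorem.
\<close>

section \<open>Differentiation of indefinite integrals\<close>

text \<open>Two mismatches shape the proof. \<open>AC_rep\<close> is an arbitrary choice, determined
  only on [a,b], while \<open>deriv\<close> is two-sided; so derivatives are taken inside the open
  interval, where all representatives coincide near the point. And kernels are measurable for the
  completed measure of the plane, while Fubini concerns product measures; sections therefore behave
  well only for almost every point. Both sides of the theorem share one composition lemma. The
  weight is attached to the function, as \<open>g = \<omega> f\<close>, and the right-hand case is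
  obtained from the transposed kernels. The composition lemma controls \<open>\<omega> J\<close> for
  the inner integral \<open>J\<close>; boundedness of \<open>1 / \<omega>\<close> brings
  \<open>J\<close> itself back into L^1, as the definition of the derivative demands.\<close>

text \<open>
  On the set where, at arbitrarily small scales, the difference quotient of the indefinite
  integral is \<open>e\<close>-far from \<open>g x\<close>, pairwise disjoint bad intervals form a fine tagged partial division, so
  Henstock's lemma makes their total length arbitrarily small.
\<close>

lemma negligible_non_derivative:
  fixes g :: "real \<Rightarrow> real"
  assumes g: "g integrable_on {a..b}"
  shows "negligible {x \<in> {a<..<b}.
    \<not> ((\<lambda>x. integral {a..x} g) has_real_derivative g x) (at x)}"
proof -
  define F where "F = (\<lambda>x. integral {a..x} g)"
  \<comment> \<open>The error of the difference quotient, cleared of its denominator. The point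
    \<open>y\<close> stays in [a,b] because \<open>g\<close> is known to be integrable only
    there.\<close>
  define bad where "bad e x y \<longleftrightarrow> y \<in> {a..b} \<and> y \<noteq> x \<and> e * \<bar>y - x\<bar> \<le> \<bar>F y - F x - g x * (y - x)\<bar>"
    for e x y :: real
  define E where "E e = {x \<in> {a<..<b}. \<forall>d>0. \<exists>y. bad e x y \<and> \<bar>y - x\<bar> < d}" for e
  \<comment> \<open>The linearization error of \<open>F\<close> is exactly the Henstock error of the
    cell between \<open>x\<close> and \<open>y\<close>, tagged at its end point
    \<open>x\<close>.\<close>
  have F_diff: "\<bar>F y - F x - g x * (y - x)\<bar>
      = norm (measure lborel {min x y..max x y} *\<^sub>R g x - integral {min x y..max x y} g)"
    if "x \<in> {a..b}" "y \<in> {a..b}" for x y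
  proof (cases "x \<le> y")
    case True
    have "F x + integral {x..y} g = F y" unfolding F_def
      using that True by (intro Henstock_Kurzweil_Integration.integral_combine
          integrable_subinterval_real[OF g]) auto
    with True show ?thesis by (simp add: min_def max_def algebra_simps abs_minus_commute)
  next
    case False
    have "F y + integral {y..x} g = F x" unfolding F_def
      using that False by (intro Henstock_Kurzweil_Integration.integral_combine
          integrable_subinterval_real[OF g]) auto
    with False show ?thesis by (simp add: min_def max_def algebra_simps abs_minus_commute)
  qed
  have neg_E: "negligible (E e)" if e: "e > 0" for e
    unfolding negligible_outer_le
  proof (intro allI impI)
    fix \<epsilon> :: real assume \<epsilon>: "\<epsilon> > 0"
    \<comment> \<open>A bad cell has Henstock error at least \<open>e\<close> times its length, so
      the tolerance \<open>e * \<epsilon>\<close> leaves \<open>\<epsilon>\<close> for the total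
      length.\<close>
    obtain \<gamma> where \<gamma>: "gauge \<gamma>"
      and small: "\<And>p. \<lbrakk>p tagged_partial_division_of (cbox a b); \<gamma> fine p\<rbrakk> \<Longrightarrow>
        (\<Sum>(x,k)\<in>p. norm (measure lborel k *\<^sub>R g x - integral k g)) < e * \<epsilon>"
      using Henstock_lemma[of g a b "e * \<epsilon>"] g e \<epsilon> by auto
    \<comment> \<open>The Vitali theorem speaks of balls, so a cell is described by its midpoint and
      half its length. Indexing by pairs keeps the tag, which is an end point and not the
      centre.\<close>
    define cen rad where "cen = (\<lambda>(x::real, y). (x + y) / 2)" and "rad = (\<lambda>(x::real, y). \<bar>y - x\<bar> / 2)"
    define J where "J = (\<lambda>(x::real, y). {min x y..max x y})"
    have cball_J: "cball (cen i) (rad i) = J i" for i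
      by (cases i) (auto simp: cen_def rad_def J_def cball_eq_atLeastAtMost abs_if min_def max_def field_simps)
    define K where "K = {(x, y). x \<in> {a<..<b} \<and> bad e x y \<and> J (x, y) \<subseteq> \<gamma> x}"
    obtain C where C: "countable C" "C \<subseteq> K"
        and disj: "pairwise (\<lambda>i j. disjnt (J i) (J j)) C"
        and cov: "negligible (E e - (\<Union>i\<in>C. J i))"
    proof (rule Vitali_covering_theorem_cballs[of K rad "E e" cen])
      show "rad i > 0" if "i \<in> K" for i
        using that by (auto simp: K_def rad_def bad_def)
      show "\<exists>i. i \<in> K \<and> x \<in> cball (cen i) (rad i) \<and> rad i < d" if x: "x \<in> E e" "0 < d" for x d
      proof -
        obtain r where r: "r > 0" "ball x r \<subseteq> \<gamma> x"
          using \<gamma> unfolding gauge_def by (meson openE)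
        \<comment> \<open>The bound \<open>r\<close> keeps the cell inside the gauge neighbourhood;
          \<open>d\<close> meets the Vitali demand for arbitrarily small radii.\<close>
        obtain y where y: "bad e x y" "\<bar>y - x\<bar> < min d r"
          using x r by (auto simp: E_def simp del: min_less_iff_conj dest!: spec[of _ "min d r"])
        have "J (x, y) \<subseteq> ball x r"
          using y by (auto simp: J_def dist_real_def)
        then have "(x, y) \<in> K" using r x y by (auto simp: K_def E_def)
        moreover have "x \<in> cball (cen (x,y)) (rad (x,y))"
          unfolding cball_J by (auto simp: J_def)
        moreover have "rad (x, y) < d" using y by (auto simp: rad_def)
        ultimately show ?thesis by blast
      qed
    qed (auto simp: cball_J)
    have J_lm: "J i \<in> lmeasurable" for i by (auto simp: J_def split: prod.split)
    \<comment> \<open>Henstock's lemma sees only finite families. The bound is the same for all of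
      them and hence passes to the countable union.\<close>
    have fin: "measure lebesgue (\<Union>i\<in>D. J i) \<le> \<epsilon>" if D: "D \<subseteq> C" "finite D" for D
    proof -
      have DK: "D \<subseteq> K" using D C by blast
      have disjD: "pairwise (\<lambda>i j. disjnt (J i) (J j)) D" using disj D by (meson pairwise_subset)
      define p where "p = (\<lambda>i. (fst i, J i)) ` D"
      have in_J: "fst i \<in> J i" for i by (cases i) (auto simp: J_def)
      have inj: "inj_on (\<lambda>i. (fst i, J i)) D"
      proof (rule inj_onI)
        fix i j assume "i \<in> D" "j \<in> D" and eq: "(fst i, J i) = (fst j, J j)"
        then show "i = j"
          using disjD in_J[of i] by (auto simp: pairwise_def disjnt_def)
      qed
      have "p tagged_partial_division_of (cbox a b)"
        unfolding tagged_partial_division_of_def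
      proof (intro conjI allI impI)
        show "finite p" using D by (simp add: p_def)
        fix x k assume "(x, k) \<in> p"
        then obtain i where i: "i \<in> D" "x = fst i" "k = J i" by (auto simp: p_def)
        show "x \<in> k" using i in_J by simp
        have "J i \<subseteq> cbox a b" if "i \<in> K"
          using that by (auto simp: K_def J_def bad_def min_def max_def split: if_splits)
        then show "k \<subseteq> cbox a b" using i DK by auto
        show "\<exists>u v. k = cbox u v" using i by (auto simp: J_def split: prod.split)
      next
        fix x1 K1 x2 K2 assume "(x1, K1) \<in> p \<and> (x2, K2) \<in> p \<and> (x1, K1) \<noteq> (x2, K2)"
        then obtain i j where "i \<in> D" "j \<in> D" "K1 = J i" "K2 = J j" "i \<noteq> j"
          by (auto simp: p_def)
        then have "K1 \<inter> K2 = {}" using disjD by (auto simp: pairwise_def disjnt_def)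
        then show "interior K1 \<inter> interior K2 = {}" using interior_subset by blast
      qed
      moreover have "\<gamma> fine p"
        using DK by (fastforce simp: fine_def p_def K_def)
      ultimately have "(\<Sum>(x,k)\<in>p. norm (measure lborel k *\<^sub>R g x - integral k g)) < e * \<epsilon>"
        by (rule small)
      moreover have "(\<Sum>(x,k)\<in>p. norm (measure lborel k *\<^sub>R g x - integral k g))
          = (\<Sum>i\<in>D. norm (measure lborel (J i) *\<^sub>R g (fst i) - integral (J i) g))"
        unfolding p_def by (subst sum.reindex[OF inj]) simp
      moreover have "e * measure lebesgue (J i) \<le> norm (measure lborel (J i) *\<^sub>R g (fst i) - integral (J i) g)"
        if "i \<in> D" for i
      proof -
        obtain x y where xy: "i = (x, y)" by (cases i)
        then have "(x, y) \<in> K" using that DK by auto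
        then have xy': "x \<in> {a<..<b}" "bad e x y" by (auto simp: K_def)
        have "norm (measure lborel (J i) *\<^sub>R g (fst i) - integral (J i) g) = \<bar>F y - F x - g x * (y - x)\<bar>"
          using xy' by (subst F_diff) (auto simp: xy J_def bad_def)
        moreover have "measure lebesgue (J i) = \<bar>y - x\<bar>"
          by (auto simp: xy J_def)
        ultimately show ?thesis using xy' by (simp add: bad_def)
      qed
      then have "(\<Sum>i\<in>D. e * measure lebesgue (J i))
          \<le> (\<Sum>i\<in>D. norm (measure lborel (J i) *\<^sub>R g (fst i) - integral (J i) g))"
        by (rule sum_mono)
      ultimately have "e * (\<Sum>i\<in>D. measure lebesgue (J i)) \<le> e * \<epsilon>"
        by (simp add: sum_distrib_left)
      then have "(\<Sum>i\<in>D. measure lebesgue (J i)) \<le> \<epsilon>" using e by simp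
      then show ?thesis
        using measure_UNION'[OF D(2), of J] J_lm disjD by simp
    qed
    have U: "(\<Union>i\<in>C. J i) \<in> lmeasurable" "measure lebesgue (\<Union>i\<in>C. J i) \<le> \<epsilon>"
      using fmeasurable_UN_bound[OF C(1) J_lm fin] measure_UN_bound[OF C(1) J_lm fin] by auto
    show "\<exists>T. E e \<subseteq> T \<and> T \<in> lmeasurable \<and> measure lebesgue T \<le> \<epsilon>"
    proof (intro exI conjI)
      let ?N = "E e - (\<Union>i\<in>C. J i)"
      show "E e \<subseteq> (\<Union>i\<in>C. J i) \<union> ?N" by blast
      show "(\<Union>i\<in>C. J i) \<union> ?N \<in> lmeasurable"
        using U cov negligible_imp_measurable by blast
      show "measure lebesgue ((\<Union>i\<in>C. J i) \<union> ?N) \<le> \<epsilon>"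
        using U cov by (subst measure_Un_null_set) (auto simp: negligible_iff_null_sets)
    qed
  qed
  \<comment> \<open>If the quotients fail to converge to \<open>g x\<close>, they do so with some
    threshold 1/(n+1), so countably many null sets suffice.\<close>
  have "x \<in> (\<Union>n. E (1 / Suc n))"
    if x: "x \<in> {a<..<b}" and nd: "\<not> (F has_real_derivative g x) (at x)" for x
  proof (rule ccontr)
    assume notin: "x \<notin> (\<Union>n. E (1 / Suc n))"
    have "((\<lambda>y. (F y - F x) / (y - x)) \<longlongrightarrow> g x) (at x)"
    proof (rule tendstoI)
      fix e :: real assume "e > 0"
      then obtain n where n: "1 / Suc n < e" by (metis nat_approx_posE)
      then obtain d where d: "d > 0" "\<And>y. \<bar>y - x\<bar> < d \<Longrightarrow> \<not> bad (1 / Suc n) x y"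
        using notin x unfolding E_def by (auto dest!: spec[of _ n])
      have "eventually (\<lambda>y. y \<in> {a<..<b}) (at x)"
        using x by (intro eventually_at_in_open') auto
      moreover have "eventually (\<lambda>y. \<bar>y - x\<bar> < d) (at x)"
        using d by (auto simp: eventually_at dist_real_def)
      moreover have "eventually (\<lambda>y. y \<noteq> x) (at x)" by (simp add: eventually_at_filter)
      ultimately show "\<forall>\<^sub>F y in at x. dist ((F y - F x) / (y - x)) (g x) < e"
      proof eventually_elim
        case (elim y)
        with d have "\<bar>F y - F x - g x * (y - x)\<bar> < 1 / Suc n * \<bar>y - x\<bar>"
          by (force simp: bad_def not_le)
        also have "\<dots> < e * \<bar>y - x\<bar>" using n elim by (intro mult_strict_right_mono) auto
        finally have "\<bar>F y - F x - g x * (y - x)\<bar> / \<bar>y - x\<bar> < e"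
          using elim by (simp add: divide_less_eq)
        moreover have "(F y - F x) / (y - x) - g x = (F y - F x - g x * (y - x)) / (y - x)"
          using elim by (simp add: field_simps)
        ultimately show ?case by (simp add: dist_real_def abs_divide)
      qed
    qed
    with nd show False by (simp add: has_field_derivative_iff)
  qed
  then have "{x \<in> {a<..<b}. \<not> (F has_real_derivative g x) (at x)} \<subseteq> (\<Union>n. E (1 / Suc n))"
    by blast
  moreover have "negligible (\<Union>n. E (1 / Suc n))"
    by (intro negligible_Union_nat neg_E) auto
  ultimately show ?thesis unfolding F_def by (rule negligible_subset[rotated])
qed

section \<open>Absolutely continuous representatives\<close>

text \<open>Split |g| into its truncation at height \<open>n\<close> and the excess. The excess has
  small integral by dominated convergence, and the truncation contributes at most \<open>n\<close>
  times the measure of \<open>A\<close>.\<close>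

lemma integrable_imp_small_integral:
  fixes g :: "'a \<Rightarrow> real"
  assumes g: "integrable M g" and "e > 0"
  obtains d where "d > 0"
    "\<And>A. A \<in> sets M \<Longrightarrow> emeasure M A < ennreal d \<Longrightarrow> (LINT x|M. indicator A x * \<bar>g x\<bar>) < e"
proof -
  have [measurable]: "g \<in> borel_measurable M" using g by simp
  have lim: "(\<lambda>n. LINT x|M. min \<bar>g x\<bar> (real n)) \<longlonglongrightarrow> (LINT x|M. \<bar>g x\<bar>)"
  proof (rule integral_dominated_convergence[where w = "\<lambda>x. \<bar>g x\<bar>"])
    show "AE x in M. (\<lambda>n. min \<bar>g x\<bar> (real n)) \<longlonglongrightarrow> \<bar>g x\<bar>"
    proof (rule AE_I2)
      fix x
      obtain N where "\<bar>g x\<bar> \<le> real N" using real_arch_simple by blast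
      then have "eventually (\<lambda>n. min \<bar>g x\<bar> (real n) = \<bar>g x\<bar>) sequentially"
        by (intro eventually_sequentiallyI[of N]) auto
      then show "(\<lambda>n. min \<bar>g x\<bar> (real n)) \<longlonglongrightarrow> \<bar>g x\<bar>" by (rule tendsto_eventually)
    qed
  qed (use g in auto)
  then obtain n where n: "\<bar>(LINT x|M. min \<bar>g x\<bar> (real n)) - (LINT x|M. \<bar>g x\<bar>)\<bar> < e / 2"
    using \<open>e > 0\<close> by (metis LIMSEQ_D half_gt_zero order_refl real_norm_def)
  have int_min: "integrable M (\<lambda>x. min \<bar>g x\<bar> (real n))"
    using g by (rule Bochner_Integration.integrable_bound) auto
  show thesis
  proof
    \<comment> \<open>Half of \<open>e\<close> is spent on the excess, the other half on
      \<open>n\<close> times the measure. Adding 1 avoids division by zero when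
      \<open>n = 0\<close>.\<close>
    show "e / (2 * (real n + 1)) > 0" using \<open>e > 0\<close> by simp
    fix A assume A[measurable]: "A \<in> sets M" and small: "emeasure M A < ennreal (e / (2 * (real n + 1)))"
    then have fin: "emeasure M A < \<infinity>" using ennreal_less_top less_trans by (metis infinity_ennreal_def)
    have mA: "measure M A < e / (2 * (real n + 1))"
      using small fin \<open>e > 0\<close> by (simp add: emeasure_eq_ennreal_measure less_top ennreal_less_iff)
    have "(LINT x|M. indicator A x * \<bar>g x\<bar>)
        \<le> (LINT x|M. (\<bar>g x\<bar> - min \<bar>g x\<bar> (real n)) + real n * indicator A x)"
    proof (rule integral_mono)
      show "integrable M (\<lambda>x. indicator A x * \<bar>g x\<bar>)"
        using integrable_mult_indicator[OF A integrable_abs[OF g]] by simp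
      show "integrable M (\<lambda>x. (\<bar>g x\<bar> - min \<bar>g x\<bar> (real n)) + real n * indicator A x)"
        using g int_min fin A by (intro Bochner_Integration.integrable_add
            Bochner_Integration.integrable_diff integrable_mult_right integrable_abs) auto
    qed (auto simp: indicator_def)
    also have "\<dots> = (LINT x|M. \<bar>g x\<bar>) - (LINT x|M. min \<bar>g x\<bar> (real n)) + real n * measure M A"
      using g int_min fin A by simp
    also have "real n * measure M A \<le> real n * (e / (2 * (real n + 1)))"
      using mA by (intro mult_left_mono) auto
    also have "\<dots> \<le> e / 2" using \<open>e > 0\<close> by (simp add: field_simps)
    finally show "(LINT x|M. indicator A x * \<bar>g x\<bar>) < e" using n by linarith
  qed
qed

text \<open>The increments over disjoint intervals sum to at most the integral of |g| over their
  union, which has small measure. The parameters serve both sides: \<open>c = 0\<close>,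
  \<open>s = 1\<close> for an initial integral, and \<open>c\<close> the total integral,
  \<open>s = -1\<close> for a tail.\<close>

lemma abs_continuous_indefinite_integral:
  fixes g :: "real \<Rightarrow> real"
  assumes g: "integrable lebesgue g"
  shows "abs_continuous a b (\<lambda>x. c + s * (LINT y|lebesgue. indicator {..<x} y * g y))"
  unfolding abs_continuous_def
proof (intro allI impI)
  fix \<epsilon> :: real assume "\<epsilon> > 0"
  define \<Phi> where "\<Phi> x = (LINT y|lebesgue. indicator {..<x} y * g y)" for x
  have int_ind: "integrable lebesgue (\<lambda>y. indicator A y * h y)"
    if "A \<in> sets lebesgue" "integrable lebesgue h" for A and h :: "real \<Rightarrow> real"
    using integrable_mult_indicator[OF that] by simp
  \<comment> \<open>The denominator absorbs the factor \<open>s\<close> and stays positive when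
    \<open>s = 0\<close>.\<close>
  obtain d where d: "d > 0" and small: "\<And>A. A \<in> sets lebesgue \<Longrightarrow> emeasure lebesgue A < ennreal d \<Longrightarrow>
      (LINT x|lebesgue. indicator A x * \<bar>g x\<bar>) < \<epsilon> / (\<bar>s\<bar> + 1)"
    using integrable_imp_small_integral[OF g, of "\<epsilon> / (\<bar>s\<bar> + 1)"] \<open>\<epsilon> > 0\<close>
    by (auto simp: add_nonneg_pos)
  show "\<exists>\<delta>>0. \<forall>(n::nat) u v. (\<forall>i<n. a \<le> u i \<and> u i \<le> v i \<and> v i \<le> b) \<longrightarrow>
     disjoint_family_on (\<lambda>i. {u i<..<v i}) {..<n} \<longrightarrow>
     (\<Sum>i<n. v i - u i) < \<delta> \<longrightarrow> (\<Sum>i<n. \<bar>(c + s * \<Phi> (v i)) - (c + s * \<Phi> (u i))\<bar>) < \<epsilon>"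
  proof (intro exI[of _ d] conjI d allI impI)
    fix n :: nat and u v :: "nat \<Rightarrow> real"
    assume uv: "\<forall>i<n. a \<le> u i \<and> u i \<le> v i \<and> v i \<le> b"
      and dis: "disjoint_family_on (\<lambda>i. {u i<..<v i}) {..<n}"
      and sm: "(\<Sum>i<n. v i - u i) < d"
    \<comment> \<open>Half-open cells make the difference of two half-line indicators an exact
      indicator. They remain disjoint, since two overlapping ones would share an interval.\<close>
    define A where "A i = {u i..<v i}" for i
    have disA: "disjoint_family_on A {..<n}"
      unfolding disjoint_family_on_def
    proof (intro ballI impI)
      fix i j assume ij: "i \<in> {..<n}" "j \<in> {..<n}" "i \<noteq> j"
      then have *: "{u i<..<v i} \<inter> {u j<..<v j} = {}" using dis by (simp add: disjoint_family_on_def)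
      show "A i \<inter> A j = {}"
      proof (rule ccontr)
        assume "A i \<inter> A j \<noteq> {}"
        then have "max (u i) (u j) < min (v i) (v j)" by (auto simp: A_def)
        then obtain z where "max (u i) (u j) < z" "z < min (v i) (v j)" using dense by blast
        then have "z \<in> {u i<..<v i} \<inter> {u j<..<v j}" by auto
        with * show False by blast
      qed
    qed
    have "\<bar>\<Phi> (v i) - \<Phi> (u i)\<bar> \<le> (LINT y|lebesgue. indicator (A i) y * \<bar>g y\<bar>)" if "i < n" for i
    proof -
      have "\<Phi> (v i) - \<Phi> (u i)
          = (LINT y|lebesgue. indicator {..<v i} y * g y - indicator {..<u i} y * g y)"
        unfolding \<Phi>_def by (intro Bochner_Integration.integral_diff[symmetric] int_ind g) auto
      also have "\<dots> = (LINT y|lebesgue. indicator (A i) y * g y)"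
        using uv that by (intro Bochner_Integration.integral_cong) (auto simp: A_def indicator_def)
      also have "\<bar>\<dots>\<bar> \<le> (LINT y|lebesgue. \<bar>indicator (A i) y * g y\<bar>)" by (rule integral_abs_bound)
      finally show ?thesis by (simp add: abs_mult)
    qed
    then have "(\<Sum>i<n. \<bar>\<Phi> (v i) - \<Phi> (u i)\<bar>) \<le> (\<Sum>i<n. LINT y|lebesgue. indicator (A i) y * \<bar>g y\<bar>)"
      by (intro sum_mono) auto
    also have "\<dots> = (LINT y|lebesgue. (\<Sum>i<n. indicator (A i) y * \<bar>g y\<bar>))"
      by (intro Bochner_Integration.integral_sum[symmetric] int_ind integrable_abs g) (auto simp: A_def)
    also have "\<dots> = (LINT y|lebesgue. indicator (\<Union>i<n. A i) y * \<bar>g y\<bar>)"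
      by (simp add: indicator_UN_disjoint[OF _ disA] sum_distrib_right)
    also have "\<dots> < \<epsilon> / (\<bar>s\<bar> + 1)"
    proof (rule small)
      show "(\<Union>i<n. A i) \<in> sets lebesgue" by (auto simp: A_def)
      have "emeasure lebesgue (\<Union>i<n. A i) \<le> (\<Sum>i<n. emeasure lebesgue (A i))"
        by (rule emeasure_subadditive_finite) (auto simp: A_def)
      also have "\<dots> = (\<Sum>i<n. ennreal (v i - u i))"
        using uv by (intro sum.cong) (auto simp: A_def)
      also have "\<dots> = ennreal (\<Sum>i<n. v i - u i)"
        using uv by (intro sum_ennreal) auto
      also have "\<dots> < ennreal d" using sm uv by (subst ennreal_less_iff) (auto intro!: sum_nonneg)
      finally show "emeasure lebesgue (\<Union>i<n. A i) < ennreal d" .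
    qed
    finally have *: "(\<Sum>i<n. \<bar>\<Phi> (v i) - \<Phi> (u i)\<bar>) < \<epsilon> / (\<bar>s\<bar> + 1)" .
    have "\<bar>(c + s * \<Phi> (v i)) - (c + s * \<Phi> (u i))\<bar> = \<bar>s\<bar> * \<bar>\<Phi> (v i) - \<Phi> (u i)\<bar>" for i
      by (simp add: abs_mult[symmetric] right_diff_distrib)
    then have "(\<Sum>i<n. \<bar>(c + s * \<Phi> (v i)) - (c + s * \<Phi> (u i))\<bar>) = \<bar>s\<bar> * (\<Sum>i<n. \<bar>\<Phi> (v i) - \<Phi> (u i)\<bar>)"
      by (simp add: sum_distrib_left)
    also have "\<dots> \<le> (\<bar>s\<bar> + 1) * (\<Sum>i<n. \<bar>\<Phi> (v i) - \<Phi> (u i)\<bar>)"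
      by (intro mult_right_mono sum_nonneg) auto
    also have "\<dots> < \<epsilon>" using * by (simp add: pos_less_divide_eq mult.commute add_nonneg_pos)
    finally show "(\<Sum>i<n. \<bar>(c + s * \<Phi> (v i)) - (c + s * \<Phi> (u i))\<bar>) < \<epsilon>" .
  qed
qed

section \<open>Uniqueness and derivative of the absolutely continuous representative\<close>

lemma abs_continuous_imp_continuous_on:
  assumes "abs_continuous a b h"
  shows "continuous_on {a..b} h"
  unfolding continuous_on_iff
proof (intro ballI allI impI)
  fix x e :: real assume x: "x \<in> {a..b}" and "e > 0"
  then obtain d where d: "d > 0" and ac: "\<And>(n::nat) u v. (\<forall>i<n. a \<le> u i \<and> u i \<le> v i \<and> v i \<le> b) \<Longrightarrow>
     disjoint_family_on (\<lambda>i. {u i<..<v i}) {..<n} \<Longrightarrow>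
     (\<Sum>i<n. v i - u i) < d \<Longrightarrow> (\<Sum>i<n. \<bar>h (v i) - h (u i)\<bar>) < e"
    using assms unfolding abs_continuous_def by meson
  show "\<exists>d>0. \<forall>x'\<in>{a..b}. dist x' x < d \<longrightarrow> dist (h x') (h x) < e"
  proof (intro exI[of _ d] conjI d ballI impI)
    fix y assume "y \<in> {a..b}" "dist y x < d"
    then show "dist (h y) (h x) < e"
      using ac[of 1 "\<lambda>_. min x y" "\<lambda>_. max x y"] x
      by (auto simp: disjoint_family_on_def dist_real_def min_def max_def abs_if split: if_splits)
  qed
qed

text \<open>Dropping the two end points, a null set, leaves interior points only, where a two-sided
  derivative is determined by the values on [a,b].\<close>

lemma AE_lebesgue_on_interval_iff:
  fixes a b :: real
  shows "(AE x in lebesgue_on {a..b}. P x) \<longleftrightarrow> (AE x in lebesgue. x \<in> {a<..<b} \<longrightarrow> P x)"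
proof -
  have "(AE x in lebesgue_on {a..b}. P x) \<longleftrightarrow> (AE x in lebesgue. x \<in> {a..b} \<longrightarrow> P x)"
    by (rule AE_restrict_space_iff) auto
  also have "\<dots> \<longleftrightarrow> (AE x in lebesgue. x \<in> {a<..<b} \<longrightarrow> P x)"
  proof -
    have "AE x in lebesgue. x \<noteq> a \<and> x \<noteq> b"
      using AE_lborel_singleton[of a] AE_lborel_singleton[of b] by (auto intro!: AE_completion)
    then show ?thesis by (auto elim: AE_mp)
  qed
  finally show ?thesis .
qed

text \<open>By continuity the points of the open interval where two representatives differ form an
  open set. It is also null, hence empty.\<close>

lemma is_AC_rep_unique:
  assumes h1: "is_AC_rep a b G h1" and h2: "is_AC_rep a b G h2" and x: "x \<in> {a<..<b}"
  shows "h1 x = h2 x"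
proof -
  define U where "U = {x \<in> {a<..<b}. h1 x - h2 x \<noteq> 0}"
  have "continuous_on {a<..<b} (\<lambda>x. h1 x - h2 x)"
    using h1 h2 unfolding is_AC_rep_def
    by (intro continuous_on_diff continuous_on_subset[OF abs_continuous_imp_continuous_on]) auto
  then have "open ({a<..<b} \<inter> (\<lambda>x. h1 x - h2 x) -` (- {0}))"
    by (rule continuous_open_preimage) auto
  also have "{a<..<b} \<inter> (\<lambda>x. h1 x - h2 x) -` (- {0}) = U" by (auto simp: U_def)
  finally have "open U" .
  have "AE x in lebesgue. x \<notin> U"
    using h1 h2 unfolding is_AC_rep_def AE_lebesgue_on_interval_iff U_def by auto
  then have "negligible U"
    by (subst negligible_iff_null_sets) (auto simp: AE_iff_null_sets \<open>open U\<close>)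
  with \<open>open U\<close> have "U = {}" using open_not_negligible by blast
  with x show ?thesis by (auto simp: U_def)
qed

text \<open>Moving the lower limit from minus infinity to \<open>a\<close> only adds the constant
  \<open>\<Phi> a\<close>. Near an interior point the chosen representative equals the indefinite
  integral on a whole neighbourhood, so it inherits the derivative.\<close>

lemma AE_deriv_AC_rep:
  fixes g :: "real \<Rightarrow> real"
  assumes g: "integrable lebesgue g"
    and G: "AE x in lebesgue_on {a..b}. G x = c + s * (LINT y|lebesgue. indicator {..<x} y * g y)"
  shows "has_AC_rep a b G \<and> (AE x in lebesgue_on {a..b}. deriv (AC_rep a b G) x = s * g x)"
proof -
  define \<Phi> where "\<Phi> x = (LINT y|lebesgue. indicator {..<x} y * g y)" for x
  define h where "h = (\<lambda>x. c + s * \<Phi> x)"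
  have rep: "is_AC_rep a b G h"
    unfolding is_AC_rep_def h_def \<Phi>_def using G abs_continuous_indefinite_integral[OF g]
    by (auto elim: AE_mp)
  then have has: "has_AC_rep a b G" by (auto simp: has_AC_rep_def)
  then have rep': "is_AC_rep a b G (AC_rep a b G)"
    unfolding has_AC_rep_def AC_rep_def by (rule someI_ex)
  have gon: "g absolutely_integrable_on {u..v}" for u v
    unfolding set_integrable_def using g by (intro integrable_mult_indicator) auto
  have int_ind: "integrable lebesgue (\<lambda>y. indicator A y * g y)" if "A \<in> sets lebesgue" for A
    using integrable_mult_indicator[OF that g] by simp
  have \<Phi>_eq: "\<Phi> x = \<Phi> a + integral {a..x} g" if "a \<le> x" for x
  proof -
    have "AE y in lebesgue. y \<noteq> x" using AE_lborel_singleton by (rule AE_completion)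
    then have "AE y in lebesgue.
        indicator {..<x} y * g y = indicator {..<a} y * g y + indicator {a..x} y * g y"
      by eventually_elim (use that in \<open>auto simp: indicator_def\<close>)
    then have "(LINT y|lebesgue. indicator {..<x} y * g y)
        = (LINT y|lebesgue. indicator {..<a} y * g y + indicator {a..x} y * g y)"
      by (intro integral_cong_AE borel_measurable_integrable
          Bochner_Integration.integrable_add int_ind) auto
    also have "\<dots> = \<Phi> a + (LINT y|lebesgue. indicator {a..x} y * g y)"
      unfolding \<Phi>_def by (intro Bochner_Integration.integral_add int_ind) auto
    also have "(LINT y|lebesgue. indicator {a..x} y * g y) = integral {a..x} g"
      using set_lebesgue_integral_eq_integral(2)[OF gon[of a x]] by (simp add: set_lebesgue_integral_def)
    finally show ?thesis by (simp add: \<Phi>_def)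
  qed
  have "g integrable_on {a..b}" using gon set_lebesgue_integral_eq_integral(1) by blast
  from negligible_non_derivative[OF this]
  have "AE x in lebesgue. x \<notin> {x \<in> {a<..<b}. \<not> ((\<lambda>x. integral {a..x} g) has_real_derivative g x) (at x)}"
    unfolding negligible_iff_null_sets by (rule AE_not_in)
  then have "AE x in lebesgue. x \<in> {a<..<b} \<longrightarrow> deriv (AC_rep a b G) x = s * g x"
  proof (rule AE_mp, intro AE_I2 impI)
    fix x assume x: "x \<in> {a<..<b}"
      and "x \<notin> {x \<in> {a<..<b}. \<not> ((\<lambda>x. integral {a..x} g) has_real_derivative g x) (at x)}"
    then have "((\<lambda>x. integral {a..x} g) has_real_derivative g x) (at x)" by blast
    then have "((\<lambda>x. c + s * (\<Phi> a + integral {a..x} g)) has_real_derivative s * g x) (at x)"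
      by (auto intro!: derivative_eq_intros)
    moreover have "eventually (\<lambda>y. y \<in> {a<..<b}) (nhds x)"
      using x by (intro eventually_nhds_in_open) auto
    then have "eventually (\<lambda>y. AC_rep a b G y = c + s * (\<Phi> a + integral {a..y} g)) (nhds x)"
    proof eventually_elim
      case (elim y)
      then show ?case using is_AC_rep_unique[OF rep' rep elim] \<Phi>_eq[of y] by (simp add: h_def)
    qed
    ultimately have "(AC_rep a b G has_real_derivative s * g x) (at x)"
      by (subst DERIV_cong_ev[OF refl _ refl])
    then show "deriv (AC_rep a b G) x = s * g x" by (rule DERIV_imp_deriv)
  qed
  with has show ?thesis by (simp add: AE_lebesgue_on_interval_iff)
qed

section \<open>Fubini's theorem for Lebesgue measurable kernels\<close>

text \<open>The bridge between \<open>lebesgue\<close>, the completion used in the definitions, and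
  \<open>lborel\<close>, to which the product theory applies. The exceptional null set may be
  non-Borel, which completion permits.\<close>

lemma lebesgue_transfer_borel:
  fixes h f :: "'a::euclidean_space \<Rightarrow> real"
  assumes f: "f \<in> borel_measurable lborel" and eq: "AE x in lborel. h x = f x"
  shows "h \<in> borel_measurable lebesgue"
    and "integrable lebesgue h \<longleftrightarrow> integrable lborel f"
    and "integral\<^sup>L lebesgue h = integral\<^sup>L lborel f"
proof -
  have f': "f \<in> borel_measurable lebesgue" using f by (rule measurable_completion)
  have eq': "AE x in lebesgue. h x = f x" using eq by (rule AE_completion)
  show h: "h \<in> borel_measurable lebesgue"
    by (rule borel_measurable_AE[OF f']) (use eq' in \<open>auto simp: eq_commute\<close>)
  show "integrable lebesgue h \<longleftrightarrow> integrable lborel f"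
    using integrable_cong_AE[OF h f' eq'] integrable_completion[OF f] by simp
  show "integral\<^sup>L lebesgue h = integral\<^sup>L lborel f"
    using integral_cong_AE[OF h f' eq'] integral_completion[OF f] by simp
qed

text \<open>
  The Lebesgue measure on the plane is only the completion of a product measure, so kernels are
  replaced by Borel representatives before the product measure theory applies.
\<close>

lemma AE_lborel_pair:
  fixes P :: "real \<Rightarrow> real \<Rightarrow> bool"
  assumes "AE z in lborel. case z of (x, y) \<Rightarrow> P x y"
  shows "AE x in lborel. AE y in lborel. P x y" and "AE y in lborel. AE x in lborel. P x y"
proof -
  have 1: "AE z in lborel \<Otimes>\<^sub>M (lborel :: real measure). case z of (x::real, y) \<Rightarrow> P x y"
    using assms unfolding lborel_prod .
  from lborel_pair.AE_pair[OF this] show "AE x in lborel. AE y in lborel. P x y" by simp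
  \<comment> \<open>The product rule fixes the first coordinate; the other order of quantifiers
    follows because swapping coordinates preserves the product measure.\<close>
  have "AE z in distr (lborel \<Otimes>\<^sub>M lborel) (lborel \<Otimes>\<^sub>M lborel) (\<lambda>(x::real, y::real). (y, x)).
      case z of (x, y) \<Rightarrow> P x y"
    using 1 by (subst lborel_pair.distr_pair_swap[symmetric])
  then have "AE z in lborel \<Otimes>\<^sub>M (lborel :: real measure).
      case (case z of (x::real, y) \<Rightarrow> (y, x)) of (x, y) \<Rightarrow> P x y"
    by (rule AE_distrD[rotated]) simp
  from lborel_pair.AE_pair[OF this] show "AE y in lborel. AE x in lborel. P x y" by simp
qed

lemma kernel_borel_representative:
  fixes p :: "real \<Rightarrow> real \<Rightarrow> real"
  assumes "(\<lambda>(x, y). p x y) \<in> borel_measurable lebesgue"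
  obtains P where "P \<in> borel_measurable (lborel \<Otimes>\<^sub>M lborel)"
    "AE x in lborel. AE y in lborel. p x y = P (x, y)"
    "AE y in lborel. AE x in lborel. p x y = P (x, y)"
proof -
  obtain P where P: "P \<in> borel_measurable lborel" "AE z in lborel. (\<lambda>(x, y). p x y) z = P z"
    using completion_ex_borel_measurable_real[OF assms] by blast
  then have "AE z in lborel. case z of (x, y) \<Rightarrow> p x y = P (x, y)"
    by (simp add: case_prod_beta)
  from that[OF _ AE_lborel_pair[OF this]] P(1) show thesis by (simp add: lborel_prod)
qed

text \<open>Sections of a function measurable for the completed plane measure may fail to be
  measurable on a null set of \<open>x\<close>. This exceptional set reappears in the composition
  formula.\<close>

lemma AE_kernel_section_measurable:
  fixes p :: "real \<Rightarrow> real \<Rightarrow> real"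
  assumes "(\<lambda>(x, y). p x y) \<in> borel_measurable lebesgue"
  shows "AE x in lebesgue. p x \<in> borel_measurable lebesgue"
proof -
  obtain P where [measurable]: "P \<in> borel_measurable (lborel \<Otimes>\<^sub>M lborel)"
    and P: "AE x in lborel. AE y in lborel. p x y = P (x, y)"
    using kernel_borel_representative[OF assms] by blast
  from P have "AE x in lborel. p x \<in> borel_measurable lebesgue"
  proof eventually_elim
    case (elim x)
    show ?case by (rule lebesgue_transfer_borel(1)[OF _ elim]) measurable
  qed
  then show ?thesis by (rule AE_completion)
qed

text \<open>Prepares the right-sided case. Swapping coordinates preserves null sets, so the swapped
  Borel version still represents the swapped kernel.\<close>

lemma kernel_transpose_measurable:
  fixes p :: "real \<Rightarrow> real \<Rightarrow> real"
  assumes "(\<lambda>(x, y). p x y) \<in> borel_measurable lebesgue"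
  shows "(\<lambda>(x, y). p y x) \<in> borel_measurable lebesgue"
proof -
  obtain P where P: "P \<in> borel_measurable lborel" "AE z in lborel. (\<lambda>(x, y). p x y) z = P z"
    using completion_ex_borel_measurable_real[OF assms] by blast
  have [measurable]: "P \<in> borel_measurable (lborel \<Otimes>\<^sub>M lborel)"
    using P(1) by (simp add: lborel_prod)
  have "AE z in distr (lborel \<Otimes>\<^sub>M lborel) (lborel \<Otimes>\<^sub>M lborel) (\<lambda>(x::real, y::real). (y, x)).
      (\<lambda>(x, y). p x y) z = P z"
    using P(2) by (subst lborel_pair.distr_pair_swap[symmetric]) (unfold lborel_prod)
  then have "AE z in lborel \<Otimes>\<^sub>M (lborel :: real measure).
      (\<lambda>(x, y). p x y) (case z of (x, y) \<Rightarrow> (y, x)) = P (case z of (x, y) \<Rightarrow> (y, x))"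
    by (rule AE_distrD[rotated]) simp
  then have "AE z in lborel. (\<lambda>(x, y). p y x) z = P (case z of (x, y) \<Rightarrow> (y, x))"
    unfolding lborel_prod by (simp add: case_prod_beta)
  moreover have "(\<lambda>z. P (case z of (x, y) \<Rightarrow> (y, x))) \<in> borel_measurable (lborel :: (real \<times> real) measure)"
    unfolding lborel_prod[symmetric] by measurable
  ultimately show ?thesis by (intro lebesgue_transfer_borel(1))
qed

text \<open>Integrating absolute values over \<open>z\<close> first gives at most \<open>C\<close>
  times the L^1 norm of \<open>g\<close>. The weight \<open>v\<close> is left general because the
  composition uses two different weights.\<close>

lemma lebesgue_kernel_Fubini:
  fixes p :: "real \<Rightarrow> real \<Rightarrow> real" and v g :: "real \<Rightarrow> real"
  assumes p: "(\<lambda>(x, y). p x y) \<in> borel_measurable lebesgue" "\<And>x y. p x y \<ge> 0"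
    and v: "v \<in> borel_measurable lebesgue" "\<And>x. v x \<ge> 0"
    and g: "integrable lebesgue g"
    and bound: "AE y in lebesgue. integrable lebesgue (\<lambda>z. v z * p z y) \<and>
      (LINT z|lebesgue. v z * p z y) \<le> C"
  shows "AE z in lebesgue. integrable lebesgue (\<lambda>y. v z * (p z y * g y))"
    and "integrable lebesgue (\<lambda>z. v z * (LINT y|lebesgue. p z y * g y))"
    and "(LINT z|lebesgue. v z * (LINT y|lebesgue. p z y * g y))
      = (LINT y|lebesgue. (LINT z|lebesgue. v z * p z y) * g y)"
proof -
  obtain P where [measurable]: "P \<in> borel_measurable (lborel \<Otimes>\<^sub>M lborel)"
    and P1: "AE x in lborel. AE y in lborel. p x y = P (x, y)"
    and P2: "AE y in lborel. AE x in lborel. p x y = P (x, y)"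
    using kernel_borel_representative[OF p(1)] by blast
  obtain V where [measurable]: "V \<in> borel_measurable lborel" and V: "AE x in lborel. v x = V x"
    using completion_ex_borel_measurable_real[OF v(1)] by blast
  obtain G where [measurable]: "G \<in> borel_measurable lborel" and G: "AE x in lborel. g x = G x"
    using completion_ex_borel_measurable_real[OF borel_measurable_integrable[OF g]] by blast
  have intG: "integrable lborel G"
    using lebesgue_transfer_borel(2)[OF _ G] g by simp
  define H where "H = (\<lambda>(z, y). V z * (P (z, y) * G y))"
  have [measurable]: "H \<in> borel_measurable (lborel \<Otimes>\<^sub>M lborel)" unfolding H_def by measurable
  have VP: "AE y in lborel. AE z in lborel. v z * p z y = V z * P (z, y)"
    using P2
  proof eventually_elim
    case (elim y)
    then show ?case using V by eventually_elim simp
  qed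
  have row: "AE z in lborel. AE y in lborel. v z * (p z y * g y) = H (z, y)"
    using P1 V
  proof eventually_elim
    case (elim z)
    show ?case using elim(1) G by eventually_elim (simp add: H_def elim(2))
  qed
  have bound': "AE y in lborel. integrable lebesgue (\<lambda>z. v z * p z y) \<and>
      (LINT z|lebesgue. v z * p z y) \<le> C"
    using bound by (simp add: AE_completion_iff)
  have VP_bound: "AE y in lborel. (\<integral>\<^sup>+z. norm (V z * P (z, y)) \<partial>lborel) \<le> ennreal C"
    using VP bound'
  proof eventually_elim
    case (elim y)
    have "integrable lborel (\<lambda>z. V z * P (z, y))" "(LINT z|lborel. V z * P (z, y)) \<le> C"
      using lebesgue_transfer_borel(2,3)[OF _ elim(1)] elim(2) by auto
    \<comment> \<open>The Borel versions themselves may be negative somewhere; their product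
      inherits its sign from \<open>v\<close> and \<open>p\<close> only almost everywhere.\<close>
    moreover have nn: "AE z in lborel. 0 \<le> V z * P (z, y)"
      using elim(1) by eventually_elim (metis mult_nonneg_nonneg p(2) v(2))
    then have "(\<integral>\<^sup>+z. norm (V z * P (z, y)) \<partial>lborel) = (\<integral>\<^sup>+z. ennreal (V z * P (z, y)) \<partial>lborel)"
      by (intro nn_integral_cong_AE) auto
    ultimately show ?case using nn_integral_eq_integral[OF _ nn] by (simp add: ennreal_leI)
  qed
  have intH: "integrable (lborel \<Otimes>\<^sub>M lborel) H"
  proof (rule integrableI_bounded)
    have "(\<integral>\<^sup>+ x. ennreal (norm (H x)) \<partial>(lborel \<Otimes>\<^sub>M lborel)) = (\<integral>\<^sup>+y. \<integral>\<^sup>+z. norm (H (z, y)) \<partial>lborel \<partial>lborel)"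
      by (rule lborel_pair.nn_integral_snd[symmetric]) measurable
    also have "\<dots> = (\<integral>\<^sup>+y. (\<integral>\<^sup>+z. norm (V z * P (z, y)) \<partial>lborel) * norm (G y) \<partial>lborel)"
      by (intro nn_integral_cong, subst nn_integral_multc[symmetric])
        (auto simp: H_def abs_mult ennreal_mult' mult_ac)
    also have "\<dots> \<le> (\<integral>\<^sup>+y. ennreal C * norm (G y) \<partial>lborel)"
    proof (rule nn_integral_mono_AE)
      show "AE y in lborel. (\<integral>\<^sup>+z. norm (V z * P (z, y)) \<partial>lborel) * norm (G y) \<le> ennreal C * norm (G y)"
        using VP_bound by eventually_elim (rule mult_right_mono, auto)
    qed
    also have "\<dots> = ennreal C * (\<integral>\<^sup>+y. norm (G y) \<partial>lborel)"
      by (rule nn_integral_cmult) measurable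
    also have "\<dots> < \<infinity>"
      using intG by (simp add: integrable_iff_bounded ennreal_mult_less_top)
    finally show "(\<integral>\<^sup>+ x. ennreal (norm (H x)) \<partial>(lborel \<Otimes>\<^sub>M lborel)) < \<infinity>" .
  qed measurable
  have "AE z in lborel. integrable lebesgue (\<lambda>y. v z * (p z y * g y))"
    using lborel_pair.AE_integrable_fst'[OF intH] row
    by eventually_elim (subst lebesgue_transfer_borel(2), auto)
  then show "AE z in lebesgue. integrable lebesgue (\<lambda>y. v z * (p z y * g y))"
    by (rule AE_completion)
  have eq1: "AE z in lborel. v z * (LINT y|lebesgue. p z y * g y) = (LINT y|lborel. H (z, y))"
    using row
  proof eventually_elim
    case (elim z)
    have "(LINT y|lebesgue. v z * (p z y * g y)) = (LINT y|lborel. H (z, y))"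
      by (rule lebesgue_transfer_borel(3)[OF _ elim]) measurable
    then show ?case by simp
  qed
  have eq2: "AE y in lborel. (LINT z|lebesgue. v z * p z y) * g y = (LINT z|lborel. H (z, y))"
    using VP G
  proof eventually_elim
    case (elim y)
    have "(LINT z|lebesgue. v z * p z y) = (LINT z|lborel. V z * P (z, y))"
      by (rule lebesgue_transfer_borel(3)[OF _ elim(1)]) measurable
    moreover have "(LINT z|lborel. H (z, y)) = (LINT z|lborel. (V z * P (z, y)) * G y)"
      by (simp add: H_def mult.assoc)
    ultimately show ?case using elim(2) by simp
  qed
  show "integrable lebesgue (\<lambda>z. v z * (LINT y|lebesgue. p z y * g y))"
    using lebesgue_transfer_borel(2)[OF _ eq1] lborel_pair.integrable_fst'[OF intH] by simp
  have "(LINT z|lborel. LINT y|lborel. H (z, y)) = (LINT y|lborel. LINT z|lborel. H (z, y))"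
    using lborel_pair.Fubini_integral[of "\<lambda>z y. H (z, y)"] intH by simp
  then show "(LINT z|lebesgue. v z * (LINT y|lebesgue. p z y * g y))
      = (LINT y|lebesgue. (LINT z|lebesgue. v z * p z y) * g y)"
    using lebesgue_transfer_borel(3)[OF _ eq1] lebesgue_transfer_borel(3)[OF _ eq2] by simp
qed

text \<open>Fubini is used with weight \<open>w\<close> and, for fixed \<open>x\<close>, with weight
  \<open>q x z * w z\<close>; in the latter case nonnegativity makes \<open>D x y\<close> itself the
  quantity to be bounded. The guard \<open>w x \<noteq> 0\<close> appears because Fubini controls
  the inner integrand only after multiplication by \<open>w x\<close>.\<close>

lemma conjugate_kernels_composition:
  fixes p q D :: "real \<Rightarrow> real \<Rightarrow> real" and w g :: "real \<Rightarrow> real"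
  assumes p: "(\<lambda>(x, y). p x y) \<in> borel_measurable lebesgue" "\<And>x y. p x y \<ge> 0"
    and q: "(\<lambda>(x, y). q x y) \<in> borel_measurable lebesgue" "\<And>x y. q x y \<ge> 0"
    and w: "w \<in> borel_measurable lebesgue" "\<And>x. w x \<ge> 0"
    and g: "integrable lebesgue g"
    and bound: "AE y in lebesgue. integrable lebesgue (\<lambda>z. w z * p z y) \<and>
      (LINT z|lebesgue. w z * p z y) \<le> C"
    and D: "\<And>x y. has_bochner_integral lebesgue (\<lambda>z. q x z * w z * p z y) (D x y)"
      "\<And>x y. D x y \<le> B"
  shows "AE x in lebesgue. w x \<noteq> 0 \<longrightarrow> integrable lebesgue (\<lambda>y. p x y * g y)"
    and "integrable lebesgue (\<lambda>x. w x * (LINT y|lebesgue. p x y * g y))"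
    and "AE x in lebesgue. has_bochner_integral lebesgue
      (\<lambda>z. q x z * w z * (LINT y|lebesgue. p z y * g y)) (LINT y|lebesgue. D x y * g y)"
proof -
  note Fub = lebesgue_kernel_Fubini[OF p _ _ g]
  show "AE x in lebesgue. w x \<noteq> 0 \<longrightarrow> integrable lebesgue (\<lambda>y. p x y * g y)"
    using Fub(1)[OF w bound] by eventually_elim auto
  show "integrable lebesgue (\<lambda>x. w x * (LINT y|lebesgue. p x y * g y))"
    by (rule Fub(2)[OF w bound])
  show "AE x in lebesgue. has_bochner_integral lebesgue
      (\<lambda>z. q x z * w z * (LINT y|lebesgue. p z y * g y)) (LINT y|lebesgue. D x y * g y)"
    using AE_kernel_section_measurable[OF q(1)]
  proof eventually_elim
    case (elim x)
    have v: "(\<lambda>z. q x z * w z) \<in> borel_measurable lebesgue" "\<And>z. q x z * w z \<ge> 0"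
      using elim w q by auto
    have bd: "AE y in lebesgue. integrable lebesgue (\<lambda>z. q x z * w z * p z y) \<and>
      (LINT z|lebesgue. q x z * w z * p z y) \<le> B"
      using D unfolding has_bochner_integral_iff by simp
    have "(LINT z|lebesgue. q x z * w z * p z y) = D x y" for y
      using D(1) by (rule has_bochner_integral_integral_eq)
    then show ?case
      using Fub(2,3)[OF v bd] by (simp only: has_bochner_integral_iff)
  qed
qed

section \<open>Integrals with respect to conjugate kernels\<close>

text \<open>
  Extension by zero turns all integrals over subintervals of \<open>[a,b]\<close> into integrals over the line.
\<close>

definition ext_fun :: "real \<Rightarrow> real \<Rightarrow> (real \<Rightarrow> real) \<Rightarrow> real \<Rightarrow> real" where
  "ext_fun a b f x = (if x \<in> {a..b} then f x else 0)"

definition ext_ker :: "real \<Rightarrow> real \<Rightarrow> (real \<Rightarrow> real \<Rightarrow> real) \<Rightarrow> real \<Rightarrow> real \<Rightarrow> real" where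
  "ext_ker a b k x y = (if (x, y) \<in> Omega a b then k x y else 0)"

lemma Omega_sets_lebesgue: "Omega a b \<in> sets lebesgue"
proof -
  have "Omega a b = ({a..b} \<times> {a..b}) \<inter> {p. snd p < fst p}"
    by (auto simp: Omega_def)
  moreover have "closed ({a..b} \<times> {a..b})" by (intro closed_Times) auto
  moreover have "open {p :: real \<times> real. snd p < fst p}"
    by (intro open_Collect_less continuous_intros)
  ultimately have "Omega a b \<in> sets borel" by (metis borel_closed borel_open sets.Int)
  then show ?thesis by simp
qed

lemma ext_fun_L_infty:
  assumes "L_infty {a..b} h"
  shows "ext_fun a b h \<in> borel_measurable lebesgue" and "\<exists>C. AE x in lebesgue. \<bar>ext_fun a b h x\<bar> \<le> C"
proof -
  show "ext_fun a b h \<in> borel_measurable lebesgue"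
    using assms unfolding L_infty_def ext_fun_def by (subst borel_measurable_if) auto
  obtain C where "AE x in lebesgue_on {a..b}. \<bar>h x\<bar> \<le> C" using assms by (auto simp: L_infty_def)
  then have "AE x in lebesgue. x \<in> {a..b} \<longrightarrow> \<bar>h x\<bar> \<le> C" by (subst (asm) AE_restrict_space_iff) auto
  then have "AE x in lebesgue. \<bar>ext_fun a b h x\<bar> \<le> max C 0"
    by eventually_elim (auto simp: ext_fun_def)
  then show "\<exists>C. AE x in lebesgue. \<bar>ext_fun a b h x\<bar> \<le> C" by blast
qed

lemma integrable_mult_L_infty:
  fixes f :: "real \<Rightarrow> real"
  assumes h: "L_infty {a..b} h" and f: "integrable lebesgue f"
  shows "integrable lebesgue (\<lambda>x. ext_fun a b h x * f x)"
proof -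
  obtain C where C: "AE x in lebesgue. \<bar>ext_fun a b h x\<bar> \<le> C" using ext_fun_L_infty(2)[OF h] by blast
  show ?thesis
  proof (rule Bochner_Integration.integrable_bound)
    show "integrable lebesgue (\<lambda>x. C * f x)" using f by simp
    show "(\<lambda>x. ext_fun a b h x * f x) \<in> borel_measurable lebesgue"
      using ext_fun_L_infty(1)[OF h] f by (intro borel_measurable_times) auto
    show "AE x in lebesgue. norm (ext_fun a b h x * f x) \<le> norm (C * f x)"
      using C by eventually_elim (auto simp: abs_mult intro!: mult_right_mono)
  qed
qed

lemma integrable_ext_fun_iff: "integrable lebesgue (ext_fun a b f) \<longleftrightarrow> L_one a b f"
proof -
  have "ext_fun a b f = (\<lambda>x. indicator {a..b} x *\<^sub>R f x)" by (auto simp: ext_fun_def)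
  then show ?thesis by (simp add: L_one_def integrable_restrict_space)
qed

text \<open>Multiplication by the bounded function \<open>1 / \<omega>\<close> undoes the weight on
  [a,b].\<close>

lemma L_one_weighted:
  assumes w: "weight a b \<omega>" and J: "integrable lebesgue (\<lambda>x. ext_fun a b \<omega> x * J x)"
  shows "L_one a b J"
proof -
  have "integrable lebesgue (\<lambda>x. ext_fun a b (\<lambda>x. 1 / \<omega> x) x * (ext_fun a b \<omega> x * J x))"
    using w by (intro integrable_mult_L_infty J) (auto simp: weight_def)
  also have "(\<lambda>x. ext_fun a b (\<lambda>x. 1 / \<omega> x) x * (ext_fun a b \<omega> x * J x)) = ext_fun a b J"
    using w by (force simp: ext_fun_def weight_def)
  finally show ?thesis by (simp add: integrable_ext_fun_iff)
qed

lemma ext_fun_weight_nonneg: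
  assumes "weight a b \<omega>"
  shows "ext_fun a b \<omega> x \<ge> 0"
  using assms by (auto simp: ext_fun_def weight_def less_imp_le)

section \<open>Kernel bounds and conjugacy for kernels extended by zero\<close>

lemma ext_ker_nonneg:
  assumes "k \<in> kernels a b \<omega>"
  shows "ext_ker a b k x y \<ge> 0"
  using assms by (fastforce simp: ext_ker_def kernels_def)

lemma ext_ker_measurable:
  assumes "k \<in> kernels a b \<omega>"
  shows "(\<lambda>(x, y). ext_ker a b k x y) \<in> borel_measurable lebesgue"
proof -
  have "(\<lambda>z. if z \<in> Omega a b then (\<lambda>(x, y). k x y) z else 0) \<in> borel_measurable lebesgue"
    using assms by (subst borel_measurable_if) (auto simp: kernels_def Omega_sets_lebesgue)
  also have "(\<lambda>z. if z \<in> Omega a b then (\<lambda>(x, y). k x y) z else 0) = (\<lambda>(x, y). ext_ker a b k x y)"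
    by (auto simp: ext_ker_def)
  finally show ?thesis .
qed

lemma lebesgue_on_integral_eq:
  fixes f h :: "real \<Rightarrow> real"
  assumes "S \<in> sets lebesgue" "\<And>x. indicator S x * f x = h x"
  shows "integrable (lebesgue_on S) f \<longleftrightarrow> integrable lebesgue h"
    and "(LINT x|lebesgue_on S. f x) = (LINT x|lebesgue. h x)"
  using assms by (simp_all add: integrable_restrict_space integral_restrict_space)

lemma ext_ker_F_bound:
  assumes k: "k \<in> kernels a b \<omega>"
  shows "\<exists>C. AE y in lebesgue. integrable lebesgue (\<lambda>x. ext_fun a b \<omega> x * ext_ker a b k x y) \<and>
    (LINT x|lebesgue. ext_fun a b \<omega> x * ext_ker a b k x y) \<le> C"
proof -
  obtain C where 1: "AE y in lebesgue_on {a..<b}. integrable (lebesgue_on {y<..b}) (\<lambda>x. k x y * \<omega> x)"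
    and 2: "AE y in lebesgue_on {a..<b}. \<bar>F_ker b \<omega> k y\<bar> \<le> C"
    using k by (auto simp: kernels_def L_infty_def)
  have int: "AE y in lebesgue. y \<in> {a..<b} \<longrightarrow> integrable (lebesgue_on {y<..b}) (\<lambda>x. k x y * \<omega> x)"
    using 1 by (subst (asm) AE_restrict_space_iff) auto
  have bnd: "AE y in lebesgue. y \<in> {a..<b} \<longrightarrow> \<bar>F_ker b \<omega> k y\<bar> \<le> C"
    using 2 by (subst (asm) AE_restrict_space_iff) auto
  \<comment> \<open>For \<open>y\<close> outside [a,b) the extended kernel gives 0, and
    \<open>C\<close> has no prescribed sign; hence \<open>max C 0\<close>.\<close>
  have "AE y in lebesgue. integrable lebesgue (\<lambda>x. ext_fun a b \<omega> x * ext_ker a b k x y) \<and>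
    (LINT x|lebesgue. ext_fun a b \<omega> x * ext_ker a b k x y) \<le> max C 0"
    using int bnd
  proof eventually_elim
    case (elim y)
    show ?case
    proof (cases "y \<in> {a..<b}")
      case True
      then have "indicator {y<..b} x * (k x y * \<omega> x) = ext_fun a b \<omega> x * ext_ker a b k x y" for x
        by (auto simp: ext_fun_def ext_ker_def Omega_def indicator_def)
      note eq = lebesgue_on_integral_eq[OF _ this]
      show ?thesis using elim True eq by (simp add: F_ker_def)
    next
      case False
      then have "ext_ker a b k x y = 0" for x by (auto simp: ext_ker_def Omega_def)
      then show ?thesis by simp
    qed
  qed
  then show ?thesis by blast
qed

lemma ext_ker_G_bound:
  assumes k: "k \<in> kernels a b \<omega>"
  shows "\<exists>C. AE y in lebesgue. integrable lebesgue (\<lambda>x. ext_fun a b \<omega> x * ext_ker a b k y x) \<and>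
    (LINT x|lebesgue. ext_fun a b \<omega> x * ext_ker a b k y x) \<le> C"
proof -
  obtain C where 1: "AE y in lebesgue_on {a<..b}. integrable (lebesgue_on {a..<y}) (\<lambda>x. k y x * \<omega> x)"
    and 2: "AE y in lebesgue_on {a<..b}. \<bar>G_ker a \<omega> k y\<bar> \<le> C"
    using k by (auto simp: kernels_def L_infty_def)
  have int: "AE y in lebesgue. y \<in> {a<..b} \<longrightarrow> integrable (lebesgue_on {a..<y}) (\<lambda>x. k y x * \<omega> x)"
    using 1 by (subst (asm) AE_restrict_space_iff) auto
  have bnd: "AE y in lebesgue. y \<in> {a<..b} \<longrightarrow> \<bar>G_ker a \<omega> k y\<bar> \<le> C"
    using 2 by (subst (asm) AE_restrict_space_iff) auto
  have "AE y in lebesgue. integrable lebesgue (\<lambda>x. ext_fun a b \<omega> x * ext_ker a b k y x) \<and>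
    (LINT x|lebesgue. ext_fun a b \<omega> x * ext_ker a b k y x) \<le> max C 0"
    using int bnd
  proof eventually_elim
    case (elim y)
    show ?case
    proof (cases "y \<in> {a<..b}")
      case True
      then have "indicator {a..<y} x * (k y x * \<omega> x) = ext_fun a b \<omega> x * ext_ker a b k y x" for x
        by (auto simp: ext_fun_def ext_ker_def Omega_def indicator_def)
      note eq = lebesgue_on_integral_eq[OF _ this]
      show ?thesis using elim True eq by (simp add: G_ker_def)
    next
      case False
      then have "ext_ker a b k y x = 0" for x by (auto simp: ext_ker_def Omega_def)
      then show ?thesis by simp
    qed
  qed
  then show ?thesis by blast
qed

text \<open>The value 1 differs from the default 0 of a non-integrable function, so integrability
  comes for free. Off \<open>Omega\<close> no \<open>z\<close> lies strictly between
  \<open>y\<close> and \<open>x\<close> within [a,b], and the integrand vanishes.\<close>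

lemma delta_ker_has_bochner_integral:
  assumes "\<forall>(x, y)\<in>Omega a b. delta_ker \<omega> k1 k2 x y = 1"
  shows "has_bochner_integral lebesgue
    (\<lambda>z. ext_ker a b k1 x z * ext_fun a b \<omega> z * ext_ker a b k2 z y) (indicator (Omega a b) (x, y))"
proof (cases "(x, y) \<in> Omega a b")
  case True
  then have "indicator {y<..<x} z * (k1 x z * k2 z y * \<omega> z)
      = ext_ker a b k1 x z * ext_fun a b \<omega> z * ext_ker a b k2 z y" for z
    by (auto simp: ext_fun_def ext_ker_def Omega_def indicator_def)
  note eq = lebesgue_on_integral_eq[OF _ this]
  have "(LINT z|lebesgue_on {y<..<x}. k1 x z * k2 z y * \<omega> z) = 1"
    using assms True by (auto simp: delta_ker_def)
  moreover from this have "integrable (lebesgue_on {y<..<x}) (\<lambda>z. k1 x z * k2 z y * \<omega> z)"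
    using not_integrable_integral_eq by fastforce
  ultimately show ?thesis using eq True by (simp add: has_bochner_integral_iff)
next
  case False
  then have "(\<lambda>z. ext_ker a b k1 x z * ext_fun a b \<omega> z * ext_ker a b k2 z y) = (\<lambda>z. 0)"
    by (auto simp: ext_ker_def Omega_def)
  with False show ?thesis by (simp only: indicator_simps has_bochner_integral_zero not_False_eq_True)
qed

section \<open>Inversion of the left-sided and right-sided integrals\<close>

lemma left_int_eq:
  assumes "x \<in> {a..b}"
  shows "integrable (lebesgue_on {a..<x}) (\<lambda>y. k x y * f y * \<omega> y) \<longleftrightarrow>
      integrable lebesgue (\<lambda>y. ext_ker a b k x y * (ext_fun a b \<omega> y * f y))"
    and "left_int a \<omega> k f x = (LINT y|lebesgue. ext_ker a b k x y * (ext_fun a b \<omega> y * f y))"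
proof -
  have "indicator {a..<x} y * (k x y * f y * \<omega> y) = ext_ker a b k x y * (ext_fun a b \<omega> y * f y)" for y
    using assms by (auto simp: ext_fun_def ext_ker_def Omega_def indicator_def)
  note eq = lebesgue_on_integral_eq[OF _ this]
  show "integrable (lebesgue_on {a..<x}) (\<lambda>y. k x y * f y * \<omega> y) \<longleftrightarrow>
      integrable lebesgue (\<lambda>y. ext_ker a b k x y * (ext_fun a b \<omega> y * f y))"
    by (rule eq(1)) auto
  show "left_int a \<omega> k f x = (LINT y|lebesgue. ext_ker a b k x y * (ext_fun a b \<omega> y * f y))"
    unfolding left_int_def by (rule eq(2)) auto
qed

lemma right_int_eq:
  assumes "x \<in> {a..b}"
  shows "integrable (lebesgue_on {x<..b}) (\<lambda>y. k y x * f y * \<omega> y) \<longleftrightarrow>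
      integrable lebesgue (\<lambda>y. ext_ker a b k y x * (ext_fun a b \<omega> y * f y))"
    and "right_int b \<omega> k f x = (LINT y|lebesgue. ext_ker a b k y x * (ext_fun a b \<omega> y * f y))"
proof -
  have "indicator {x<..b} y * (k y x * f y * \<omega> y) = ext_ker a b k y x * (ext_fun a b \<omega> y * f y)" for y
    using assms by (auto simp: ext_fun_def ext_ker_def Omega_def indicator_def)
  note eq = lebesgue_on_integral_eq[OF _ this]
  show "integrable (lebesgue_on {x<..b}) (\<lambda>y. k y x * f y * \<omega> y) \<longleftrightarrow>
      integrable lebesgue (\<lambda>y. ext_ker a b k y x * (ext_fun a b \<omega> y * f y))"
    by (rule eq(1)) auto
  show "right_int b \<omega> k f x = (LINT y|lebesgue. ext_ker a b k y x * (ext_fun a b \<omega> y * f y))"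
    unfolding right_int_def by (rule eq(2)) auto
qed

lemma integrable_weight_mult:
  assumes "weight a b \<omega>" "L_one a b f"
  shows "integrable lebesgue (\<lambda>y. ext_fun a b \<omega> y * f y)"
proof -
  have "integrable lebesgue (\<lambda>y. ext_fun a b \<omega> y * ext_fun a b f y)"
    using assms by (intro integrable_mult_L_infty) (auto simp: weight_def integrable_ext_fun_iff)
  also have "(\<lambda>y. ext_fun a b \<omega> y * ext_fun a b f y) = (\<lambda>y. ext_fun a b \<omega> y * f y)"
    by (auto simp: ext_fun_def)
  finally show ?thesis .
qed

text \<open>The composition lemma, with \<open>p\<close> built from \<open>k\<close> and
  \<open>q\<close> from \<open>k'\<close>, yields in turn the existence of the inner integral
  \<open>J\<close>, its membership in L^1, and the existence and value of the
  \<open>k'\<close>-integral of \<open>J\<close>.\<close>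

lemma left_deriv_left_int:
  assumes w: "weight a b \<omega>"
    and k: "k \<in> kernels a b \<omega>" and k': "k' \<in> kernels a b \<omega>"
    and \<delta>: "\<forall>(x, y)\<in>Omega a b. delta_ker \<omega> k' k x y = 1"
    and f: "L_one a b f"
  shows "left_int_defined a b \<omega> k f"
    and "left_deriv_defined a b \<omega> k' (left_int a \<omega> k f)"
    and "AE x in lebesgue_on {a..b}. left_deriv a b \<omega> k' (left_int a \<omega> k f) x = f x"
proof -
  define W where "W = ext_fun a b \<omega>"
  define g where "g y = W y * f y" for y
  define J where "J = left_int a \<omega> k f"
  define G where "G = left_int a \<omega> k' J"
  have W_pos: "W x = \<omega> x \<and> W x > 0" if "x \<in> {a..b}" for x
    using w that by (auto simp: W_def ext_fun_def weight_def)
  have W0: "W x = 0" if "x \<notin> {a..b}" for x using that unfolding W_def ext_fun_def by (rule if_not_P)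
  have W: "W \<in> borel_measurable lebesgue" "\<And>x. W x \<ge> 0"
    using w ext_fun_L_infty(1) ext_fun_weight_nonneg by (auto simp: W_def weight_def)
  have g: "integrable lebesgue g"
    using integrable_weight_mult[OF w f] by (simp add: g_def[abs_def] W_def)
  obtain C where C: "AE y in lebesgue. integrable lebesgue (\<lambda>x. W x * ext_ker a b k x y) \<and>
    (LINT x|lebesgue. W x * ext_ker a b k x y) \<le> C"
    using ext_ker_F_bound[OF k] unfolding W_def by blast
  note comp = conjugate_kernels_composition[OF ext_ker_measurable[OF k] ext_ker_nonneg[OF k]
      ext_ker_measurable[OF k'] ext_ker_nonneg[OF k'] W g C
      delta_ker_has_bochner_integral[OF \<delta>, folded W_def] indicator_le_1]
  \<comment> \<open>The extended kernel describes \<open>J\<close> only on [a,b]; the factor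
    \<open>W\<close>, zero elsewhere, hides the other values.\<close>
  have J: "W x * J x = W x * (LINT y|lebesgue. ext_ker a b k x y * g y)" for x
    using W0[of x] left_int_eq(2)[of x a b \<omega> k f] by (auto simp: J_def g_def W_def)
  show "left_int_defined a b \<omega> k f"
    unfolding left_int_defined_def AE_lebesgue_on_interval_iff
    using comp(1)
  proof (eventually_elim, intro impI)
    fix x assume int: "W x \<noteq> 0 \<longrightarrow> integrable lebesgue (\<lambda>y. ext_ker a b k x y * g y)"
      and "x \<in> {a<..<b}"
    then have x: "x \<in> {a..b}" by simp
    then have "integrable lebesgue (\<lambda>y. ext_ker a b k x y * g y)" using int W_pos[OF x] by simp
    then show "integrable (lebesgue_on {a..<x}) (\<lambda>y. k x y * f y * \<omega> y)"
      by (simp only: left_int_eq(1)[OF x] g_def W_def)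
  qed
  have J1: "L_one a b J"
    using comp(2) by (intro L_one_weighted[OF w]) (simp add: J W_def[symmetric])
  have int_G: "AE x in lebesgue. x \<in> {a<..<b} \<longrightarrow>
      integrable (lebesgue_on {a..<x}) (\<lambda>y. k' x y * J y * \<omega> y) \<and>
      G x = (LINT y|lebesgue. indicator {..<x} y * g y)"
    using comp(3)
  proof eventually_elim
    case (elim x)
    \<comment> \<open>The section of \<open>Omega\<close> at \<open>x\<close> is the part of the
      half-line below \<open>x\<close> lying in [a,b], and \<open>g\<close> vanishes off
      [a,b].\<close>
    have eq: "indicator (Omega a b) (x, y) * g y = indicator {..<x} y * g y" if "x \<in> {a<..<b}" for y
      using that W0[of y] by (auto simp: g_def Omega_def indicator_def)
    from elim have "has_bochner_integral lebesgue (\<lambda>z. ext_ker a b k' x z * (W z * J z))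
        (LINT y|lebesgue. indicator (Omega a b) (x, y) * g y)"
      by (simp add: J mult.assoc)
    then have hbi: "integrable lebesgue (\<lambda>z. ext_ker a b k' x z * (ext_fun a b \<omega> z * J z))"
        "(LINT z|lebesgue. ext_ker a b k' x z * (ext_fun a b \<omega> z * J z))
          = (LINT y|lebesgue. indicator (Omega a b) (x, y) * g y)"
      by (simp_all only: has_bochner_integral_iff W_def)
    show ?case
    proof (intro impI conjI)
      assume x: "x \<in> {a<..<b}"
      then have x': "x \<in> {a..b}" by simp
      show "integrable (lebesgue_on {a..<x}) (\<lambda>y. k' x y * J y * \<omega> y)"
        using hbi(1) by (simp only: left_int_eq(1)[OF x'])
      show "G x = (LINT y|lebesgue. indicator {..<x} y * g y)"
        using hbi(2) by (simp only: left_int_eq(2)[OF x'] G_def eq[OF x])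
    qed
  qed
  have "AE x in lebesgue_on {a..b}. G x = 0 + 1 * (LINT y|lebesgue. indicator {..<x} y * g y)"
    unfolding AE_lebesgue_on_interval_iff using int_G by eventually_elim simp
  note rep = AE_deriv_AC_rep[OF g this]
  have "left_int_defined a b \<omega> k' J"
    unfolding left_int_defined_def AE_lebesgue_on_interval_iff using int_G by eventually_elim simp
  with J1 rep show "left_deriv_defined a b \<omega> k' (left_int a \<omega> k f)"
    by (simp add: left_deriv_defined_def J_def G_def)
  have "AE x in lebesgue. x \<in> {a<..<b} \<longrightarrow> deriv (AC_rep a b G) x = 1 * g x"
    using rep by (simp add: AE_lebesgue_on_interval_iff)
  then show "AE x in lebesgue_on {a..b}. left_deriv a b \<omega> k' (left_int a \<omega> k f) x = f x"
    unfolding AE_lebesgue_on_interval_iff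
  proof eventually_elim
    case (elim x)
    then show ?case
      using W_pos[of x] by (auto simp: left_deriv_def g_def J_def[symmetric] G_def[symmetric])
  qed
qed

text \<open>After transposition the composed kernel at \<open>(x, y)\<close> is
  \<open>delta_ker \<omega> k k' y x\<close>, so the other half of conjugacy enters, and the bound
  on \<open>G_ker\<close> takes the place of that on \<open>F_ker\<close>. The minus sign in
  \<open>right_deriv\<close> cancels the one from differentiating a tail integral.\<close>

lemma right_deriv_right_int:
  assumes w: "weight a b \<omega>"
    and k: "k \<in> kernels a b \<omega>" and k': "k' \<in> kernels a b \<omega>"
    and \<delta>: "\<forall>(x, y)\<in>Omega a b. delta_ker \<omega> k k' x y = 1"
    and f: "L_one a b f"
  shows "right_int_defined a b \<omega> k f"
    and "right_deriv_defined a b \<omega> k' (right_int b \<omega> k f)"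
    and "AE x in lebesgue_on {a..b}. right_deriv a b \<omega> k' (right_int b \<omega> k f) x = f x"
proof -
  define W where "W = ext_fun a b \<omega>"
  define g where "g y = W y * f y" for y
  define J where "J = right_int b \<omega> k f"
  define G where "G = right_int b \<omega> k' J"
  have W_pos: "W x = \<omega> x \<and> W x > 0" if "x \<in> {a..b}" for x
    using w that by (auto simp: W_def ext_fun_def weight_def)
  have W0: "W x = 0" if "x \<notin> {a..b}" for x using that unfolding W_def ext_fun_def by (rule if_not_P)
  have W: "W \<in> borel_measurable lebesgue" "\<And>x. W x \<ge> 0"
    using w ext_fun_L_infty(1) ext_fun_weight_nonneg by (auto simp: W_def weight_def)
  have g: "integrable lebesgue g"
    using integrable_weight_mult[OF w f] by (simp add: g_def[abs_def] W_def)
  obtain C where C: "AE y in lebesgue. integrable lebesgue (\<lambda>x. W x * ext_ker a b k y x) \<and>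
    (LINT x|lebesgue. W x * ext_ker a b k y x) \<le> C"
    using ext_ker_G_bound[OF k] unfolding W_def by blast
  have D: "has_bochner_integral lebesgue (\<lambda>z. ext_ker a b k' z x * W z * ext_ker a b k y z)
      (indicator (Omega a b) (y, x))" for x y
    using delta_ker_has_bochner_integral[OF \<delta>, of y x] by (simp add: W_def mult_ac)
  note comp = conjugate_kernels_composition[OF
      kernel_transpose_measurable[OF ext_ker_measurable[OF k]] ext_ker_nonneg[OF k]
      kernel_transpose_measurable[OF ext_ker_measurable[OF k']] ext_ker_nonneg[OF k']
      W g C D indicator_le_1]
  have J: "W x * J x = W x * (LINT y|lebesgue. ext_ker a b k y x * g y)" for x
    using W0[of x] right_int_eq(2)[of x a b \<omega> k f] by (auto simp: J_def g_def W_def)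
  show "right_int_defined a b \<omega> k f"
    unfolding right_int_defined_def AE_lebesgue_on_interval_iff
    using comp(1)
  proof (eventually_elim, intro impI)
    fix x assume int: "W x \<noteq> 0 \<longrightarrow> integrable lebesgue (\<lambda>y. ext_ker a b k y x * g y)"
      and "x \<in> {a<..<b}"
    then have x: "x \<in> {a..b}" by simp
    then have "integrable lebesgue (\<lambda>y. ext_ker a b k y x * g y)" using int W_pos[OF x] by simp
    then show "integrable (lebesgue_on {x<..b}) (\<lambda>y. k y x * f y * \<omega> y)"
      by (simp only: right_int_eq(1)[OF x] g_def W_def)
  qed
  have J1: "L_one a b J"
    using comp(2) by (intro L_one_weighted[OF w]) (simp add: J W_def[symmetric])
  have int_G: "AE x in lebesgue. x \<in> {a<..<b} \<longrightarrow>
      integrable (lebesgue_on {x<..b}) (\<lambda>y. k' y x * J y * \<omega> y) \<and>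
      G x = (LINT y|lebesgue. g y) + (-1) * (LINT y|lebesgue. indicator {..<x} y * g y)"
    using comp(3)
  proof eventually_elim
    case (elim x)
    \<comment> \<open>The tail is the total minus the initial integral, up to the null point
      \<open>x\<close>. This brings it into the form with \<open>c\<close> the total integral and
      \<open>s = -1\<close>.\<close>
    have eq: "(LINT y|lebesgue. indicator (Omega a b) (y, x) * g y)
        = (LINT y|lebesgue. g y) + (-1) * (LINT y|lebesgue. indicator {..<x} y * g y)"
      if "x \<in> {a<..<b}"
    proof -
      have int: "integrable lebesgue (\<lambda>y. indicator {..<x} y * g y)"
        using integrable_mult_indicator[OF _ g, of "{..<x}"] by simp
      have int': "integrable lebesgue (\<lambda>y. indicator {x<..} y * g y)"
        using integrable_mult_indicator[OF _ g, of "{x<..}"] by simp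
      have "AE y in lebesgue. y \<noteq> x" using AE_lborel_singleton by (rule AE_completion)
      then have "AE y in lebesgue. indicator {x<..} y * g y = g y - indicator {..<x} y * g y"
        by eventually_elim (auto simp: indicator_def)
      then have "(LINT y|lebesgue. indicator {x<..} y * g y)
          = (LINT y|lebesgue. g y - indicator {..<x} y * g y)"
        using g int int' by (intro integral_cong_AE) auto
      also have "\<dots> = (LINT y|lebesgue. g y) + (-1) * (LINT y|lebesgue. indicator {..<x} y * g y)"
        using g int by simp
      also have "(\<lambda>y. indicator {x<..} y * g y) = (\<lambda>y. indicator (Omega a b) (y, x) * g y)"
        using that W0 by (fastforce simp: g_def Omega_def indicator_def)
      finally show ?thesis .
    qed
    from elim have "has_bochner_integral lebesgue (\<lambda>z. ext_ker a b k' z x * (W z * J z))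
        (LINT y|lebesgue. indicator (Omega a b) (y, x) * g y)"
      by (simp add: J mult.assoc)
    then have hbi: "integrable lebesgue (\<lambda>z. ext_ker a b k' z x * (ext_fun a b \<omega> z * J z))"
        "(LINT z|lebesgue. ext_ker a b k' z x * (ext_fun a b \<omega> z * J z))
          = (LINT y|lebesgue. indicator (Omega a b) (y, x) * g y)"
      by (simp_all only: has_bochner_integral_iff W_def)
    show ?case
    proof (intro impI conjI)
      assume x: "x \<in> {a<..<b}"
      then have x': "x \<in> {a..b}" by simp
      show "integrable (lebesgue_on {x<..b}) (\<lambda>y. k' y x * J y * \<omega> y)"
        using hbi(1) by (simp only: right_int_eq(1)[OF x'])
      show "G x = (LINT y|lebesgue. g y) + (-1) * (LINT y|lebesgue. indicator {..<x} y * g y)"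
        using hbi(2) by (simp only: right_int_eq(2)[OF x'] G_def eq[OF x])
    qed
  qed
  have "AE x in lebesgue_on {a..b}.
      G x = (LINT y|lebesgue. g y) + (-1) * (LINT y|lebesgue. indicator {..<x} y * g y)"
    unfolding AE_lebesgue_on_interval_iff using int_G by eventually_elim simp
  note rep = AE_deriv_AC_rep[OF g this]
  have "right_int_defined a b \<omega> k' J"
    unfolding right_int_defined_def AE_lebesgue_on_interval_iff using int_G by eventually_elim simp
  with J1 rep show "right_deriv_defined a b \<omega> k' (right_int b \<omega> k f)"
    by (simp add: right_deriv_defined_def J_def G_def)
  have "AE x in lebesgue. x \<in> {a<..<b} \<longrightarrow> deriv (AC_rep a b G) x = (-1) * g x"
    using rep by (simp add: AE_lebesgue_on_interval_iff)
  then show "AE x in lebesgue_on {a..b}. right_deriv a b \<omega> k' (right_int b \<omega> k f) x = f x"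
    unfolding AE_lebesgue_on_interval_iff
  proof eventually_elim
    case (elim x)
    then show ?case
      using W_pos[of x] by (auto simp: right_deriv_def g_def J_def[symmetric] G_def[symmetric])
  qed
qed

theorem theorem4p7:
  fixes a b :: real and \<omega> f :: "real \<Rightarrow> real" and k k' :: "real \<Rightarrow> real \<Rightarrow> real"
  assumes "a < b"
    and "weight a b \<omega>"
    and "k' \<in> kernels a b \<omega>"
    and "k \<in> conj_set a b \<omega> k'"
    and "L_one a b f"
  shows "(left_int_defined a b \<omega> k f \<and>
          left_deriv_defined a b \<omega> k' (left_int a \<omega> k f) \<and>
          (AE x in lebesgue_on {a..b}. left_deriv a b \<omega> k' (left_int a \<omega> k f) x = f x)) \<and>
         (right_int_defined a b \<omega> k f \<and>
          right_deriv_defined a b \<omega> k' (right_int b \<omega> k f) \<and>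
          (AE x in lebesgue_on {a..b}. right_deriv a b \<omega> k' (right_int b \<omega> k f) x = f x))"
proof (intro conjI)
  have k: "k \<in> kernels a b \<omega>"
    and \<delta>: "\<forall>(x, y)\<in>Omega a b. delta_ker \<omega> k k' x y = 1"
      "\<forall>(x, y)\<in>Omega a b. delta_ker \<omega> k' k x y = 1"
    using assms(4) by (auto simp: conj_set_def conjugate_def)
  note left = left_deriv_left_int[OF assms(2) k assms(3) \<delta>(2) assms(5)]
  note right = right_deriv_right_int[OF assms(2) k assms(3) \<delta>(1) assms(5)]
  show "left_int_defined a b \<omega> k f" "left_deriv_defined a b \<omega> k' (left_int a \<omega> k f)"
    "AE x in lebesgue_on {a..b}. left_deriv a b \<omega> k' (left_int a \<omega> k f) x = f x"
    by (fact left)+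
  show "right_int_defined a b \<omega> k f" "right_deriv_defined a b \<omega> k' (right_int b \<omega> k f)"
    "AE x in lebesgue_on {a..b}. right_deriv a b \<omega> k' (right_int b \<omega> k f) x = f x"
    by (fact right)+
qed

end
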